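(* Let $S$ be a finite alphabet and let $X \subset S^{\mathbb{N}}$ be a (one-directional) subshift. Then the winning set $W(X) \subset \{A,B\}^{\mathbb{N}}$ is a subshift, and $\mathcal{B}(W(X)) = W(\mathcal{B}(X))$.
   Context: $S$ is a nonempty finite set (alphabet), $S^*$ is the set of finite words over $S$ (including the empty word), and $0\in\mathbb{N}$. Games: let $n \in \mathbb{N}$ or $n=\mathbb{N}$, let $X \subset S^n$ and $a \in \{A,B\}^n$ (the turn order). Two players $A$ and $B$ build a word (infinite sequence if $n=\mathbb{N}$) $w \in S^n$ one letter at a time, starting from coordinate $0$; the letter $w_i$ is chosen by player $a_i$, knowing $w_0\cdots w_{i-1}$. Player $A$ wins if $w \in X$, otherwise $B$ wins. A strategy is a function assigning a letter of $S$ to each finite word of length less than $n$ (any finite word if $n=\mathbb{N}$); a pair of strategies $(s_A,s_B)$ determines the play $w$ by $w_i = s_{a_i}(w_0\cdots w_{i-1})$. A strategy $s_A$ is winning for $A$ if the play of $(s_A,s_B)$ lies in $X$ for every strategy $s_B$. The winning set is $W(X) = \{a \in \{A,B\}^n : A \text{ has a winning strategy for the game with target set } X \text{ and turn order } a\}$. For a language $L \subset S^*$, $W(L) = \bigcup_{n\in\mathbb{N}} W(L\cap S^n)$. Subshifts: for a finite alphabet $R$, a one-directional subshift is a set of the form $\{x \in R^{\mathbb{N}} : \text{no word of } F \text{ appears in } x\}$ for some $F\subset R^*$; equivalently, a topologically closed set $X\subset R^{\mathbb N}$ with $\sigma(X) \subset X$, where $\sigma(x)_i = x_{i+1}$. A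 word $w$ appears in $x$ if $w = x_i x_{i+1}\cdots x_{i+|w|-1}$ for some $i$. $\mathcal{B}_k(X)$ is the set of words of length $k$ appearing in some point of $X$, and $\mathcal{B}(X) = \bigcup_{k\in\mathbb{N}} \mathcal{B}_k(X)$ is the language of $X$. *)

theory Defs
  imports "HOL-Library.FuncSet" "HOL-Library.Extended_Nat"
begin

section \<open>Subshifts\<close>

definition appears_in :: "'r list \<Rightarrow> (nat \<Rightarrow> 'r) \<Rightarrow> bool" where
  "appears_in w x \<longleftrightarrow> (\<exists>i. w = map x [i..<i + length w])"

definition subshift :: "'r set \<Rightarrow> (nat \<Rightarrow> 'r) set \<Rightarrow> bool" where
  "subshift R X \<longleftrightarrow>
     (\<exists>F \<subseteq> lists R. X = {x \<in> UNIV \<rightarrow> R. \<forall>w\<in>F. \<not> appears_in w x})"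

definition blocks :: "nat \<Rightarrow> (nat \<Rightarrow> 'r) set \<Rightarrow> 'r list set" where
  "blocks k X = {w. length w = k \<and> (\<exists>x\<in>X. appears_in w x)}"

definition language :: "(nat \<Rightarrow> 'r) set \<Rightarrow> 'r list set" where
  "language X = (\<Union>k. blocks k X)"


section \<open>Games\<close>

datatype player = PlayerA | PlayerB

text \<open>A game of length \<open>n\<close>, where \<open>n = \<infinity>\<close> is the game that builds an infinite sequence.
  Only the values of a strategy on words over \<open>S\<close> of length less than \<open>n\<close> are constrained;
  the other values are never consulted in a play.\<close>

definition strategies :: "'s set \<Rightarrow> enat \<Rightarrow> ('s list \<Rightarrow> 's) set" where
  "strategies S n = {w \<in> lists S. enat (length w) < n} \<rightarrow> S"

definition choice :: "player \<Rightarrow> ('s list \<Rightarrow> 's) \<Rightarrow> ('s list \<Rightarrow> 's) \<Rightarrow> 's list \<Rightarrow> 's" where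
  "choice p s\<^sub>A s\<^sub>B = (case p of PlayerA \<Rightarrow> s\<^sub>A | PlayerB \<Rightarrow> s\<^sub>B)"

primrec play_prefix ::
    "(nat \<Rightarrow> player) \<Rightarrow> ('s list \<Rightarrow> 's) \<Rightarrow> ('s list \<Rightarrow> 's) \<Rightarrow> nat \<Rightarrow> 's list" where
  "play_prefix a s\<^sub>A s\<^sub>B 0 = []"
| "play_prefix a s\<^sub>A s\<^sub>B (Suc i) =
     play_prefix a s\<^sub>A s\<^sub>B i @ [choice (a i) s\<^sub>A s\<^sub>B (play_prefix a s\<^sub>A s\<^sub>B i)]"

definition play ::
    "(nat \<Rightarrow> player) \<Rightarrow> ('s list \<Rightarrow> 's) \<Rightarrow> ('s list \<Rightarrow> 's) \<Rightarrow> nat \<Rightarrow> 's" where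
  "play a s\<^sub>A s\<^sub>B i = choice (a i) s\<^sub>A s\<^sub>B (play_prefix a s\<^sub>A s\<^sub>B i)"

definition finite_play ::
    "player list \<Rightarrow> ('s list \<Rightarrow> 's) \<Rightarrow> ('s list \<Rightarrow> 's) \<Rightarrow> 's list" where
  "finite_play a s\<^sub>A s\<^sub>B = play_prefix (\<lambda>i. a ! i) s\<^sub>A s\<^sub>B (length a)"

lemma play_prefix_eq: "play_prefix a s\<^sub>A s\<^sub>B n = map (play a s\<^sub>A s\<^sub>B) [0..<n]"
  by (induction n) (simp_all add: play_def)

lemma play_rec: "play a s\<^sub>A s\<^sub>B i = choice (a i) s\<^sub>A s\<^sub>B (map (play a s\<^sub>A s\<^sub>B) [0..<i])"
  by (simp add: play_def play_prefix_eq)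

lemma length_finite_play: "length (finite_play a s\<^sub>A s\<^sub>B) = length a"
  by (simp add: finite_play_def play_prefix_eq)

lemma finite_play_rec:
  assumes "i < length a"
  shows "finite_play a s\<^sub>A s\<^sub>B ! i = choice (a ! i) s\<^sub>A s\<^sub>B (take i (finite_play a s\<^sub>A s\<^sub>B))"
proof -
  have "take i [0..<length a] = [0..<i]"
    using assms by simp
  then show ?thesis
    using assms
    by (simp add: finite_play_def play_prefix_eq take_map play_rec[of _ _ _ i])
qed


section \<open>Winning sets\<close>

text \<open>The three versions of \<open>W\<close>: for a target set of infinite sequences, for a target set of words
  of one fixed length \<open>n\<close>, and for a language.\<close>

definition winning_set :: "'s set \<Rightarrow> (nat \<Rightarrow> 's) set \<Rightarrow> (nat \<Rightarrow> player) set" where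
  "winning_set S X =
     {a. \<exists>s\<^sub>A \<in> strategies S \<infinity>. \<forall>s\<^sub>B \<in> strategies S \<infinity>. play a s\<^sub>A s\<^sub>B \<in> X}"

definition finite_winning_set :: "'s set \<Rightarrow> nat \<Rightarrow> 's list set \<Rightarrow> player list set" where
  "finite_winning_set S n X =
     {a. length a = n \<and>
         (\<exists>s\<^sub>A \<in> strategies S (enat n). \<forall>s\<^sub>B \<in> strategies S (enat n). finite_play a s\<^sub>A s\<^sub>B \<in> X)}"

definition winning_language :: "'s set \<Rightarrow> 's list set \<Rightarrow> player list set" where
  "winning_language S L =
     (\<Union>n. finite_winning_set S n (L \<inter> {w \<in> lists S. length w = n}))"

end

(* A player with a winning strategy keeps the play inside a set T of good positions: from a word of T
   some continuation stays in T when A moves, and all of them do when B moves. A subshift is closed,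
   so for target X the only further demand on T is that it lies in the language of X. All claims then
   become manipulations of such sets: restarting from a word of T gives shift invariance; enlarging T
   by long words of the language, which are always extendable, lets A survive forever after a finite
   game; and a limit of sets for the finite games, by the pigeonhole principle on the finite alphabet,
   gives closedness. *)
theory Submission
  imports Defs
begin

section \<open>Factors, extensions and closedness of subshifts\<close>

lemma in_language_iff: "w \<in> language X \<longleftrightarrow> (\<exists>x\<in>X. appears_in w x)"
  by (simp add: language_def blocks_def)

lemma appears_in_factor:
  assumes "appears_in (u @ v @ w) x"
  shows "appears_in v x"
proof -
  obtain i where i: "u @ v @ w = map x [i..<i + length (u @ v @ w)]"
    using assms unfolding appears_in_def by blast
  have "v = take (length v) (drop (length u) (u @ v @ w))"
    by simp
  also have "\<dots> = map x [i + length u..<i + length u + length v]"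
    by (subst i) (simp add: take_map drop_map take_upt)
  finally show ?thesis
    unfolding appears_in_def by blast
qed

lemma language_factor: "u @ v @ w \<in> language X \<Longrightarrow> v \<in> language X"
  unfolding in_language_iff using appears_in_factor by blast

lemma language_take: "w \<in> language X \<Longrightarrow> take k w \<in> language X"
  using language_factor[of "[]" "take k w" "drop k w"] by simp

lemma language_subset_lists:
  assumes "X \<subseteq> UNIV \<rightarrow> S"
  shows "language X \<subseteq> lists S"
proof
  fix w assume "w \<in> language X"
  then obtain x i where x: "x \<in> X" and w: "w = map x [i..<i + length w]"
    unfolding in_language_iff appears_in_def by blast
  have "x j \<in> S" for j
    using assms x by blast
  then show "w \<in> lists S"
    by (subst w) auto
qed

text \<open>The word occurs in an infinite point, and the letter following the occurrence extends
  it.\<close>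

lemma language_extend:
  assumes "X \<subseteq> UNIV \<rightarrow> S" "w \<in> language X"
  shows "\<exists>s\<in>S. w @ [s] \<in> language X"
proof -
  obtain x i where x: "x \<in> X" "w = map x [i..<i + length w]"
    using assms(2) unfolding in_language_iff appears_in_def by blast
  have "w @ [x (i + length w)] = map x [i..<i + length (w @ [x (i + length w)])]"
    using x(2) by simp
  then have "w @ [x (i + length w)] \<in> language X"
    using x(1) unfolding in_language_iff appears_in_def by blast
  moreover have "x (i + length w) \<in> S"
    using assms(1) x(1) by blast
  ultimately show ?thesis by blast
qed

lemma subshift_subset: "subshift S X \<Longrightarrow> X \<subseteq> UNIV \<rightarrow> S"
  unfolding subshift_def by blast

lemma prefix_in_language: "x \<in> X \<Longrightarrow> map x [0..<k] \<in> language X"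
  unfolding in_language_iff appears_in_def by (metis add_0 diff_zero length_map length_upt)

text \<open>A forbidden word occurring in \<open>x\<close> would be a factor of a prefix of
  \<open>x\<close>, hence would occur in a point of \<open>X\<close>. This turns the winning
  condition on an infinite play into conditions on its finite prefixes.\<close>

lemma in_subshift_iff:
  assumes "subshift S X"
  shows "x \<in> X \<longleftrightarrow> (\<forall>k. map x [0..<k] \<in> language X)"
proof
  assume L: "\<forall>k. map x [0..<k] \<in> language X"
  obtain F where X: "X = {x \<in> UNIV \<rightarrow> S. \<forall>w\<in>F. \<not> appears_in w x}"
    using assms unfolding subshift_def by blast
  have "x k \<in> S" for k
    using L[rule_format, of "Suc k"] language_subset_lists[OF subshift_subset[OF assms]] by auto
  moreover have "\<not> appears_in w x" if "w \<in> F" for w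
  proof
    assume "appears_in w x"
    then obtain i where "w = map x [i..<i + length w]"
      unfolding appears_in_def by blast
    then have "map x [0..<i + length w] = map x [0..<i] @ w @ []"
      by (metis append_Nil2 map_append upt_add_eq_append zero_le)
    then have "w \<in> language X"
      using L language_factor by metis
    then show False
      using that unfolding in_language_iff X by blast
  qed
  ultimately show "x \<in> X"
    unfolding X by blast
qed (simp add: prefix_in_language)

section \<open>Sets of winning positions and strategies\<close>

text \<open>The bound \<open>n\<close> is an \<open>enat\<close> so that finite and infinite games
  share one notion; words of length \<open>n\<close> end a finite game and owe no continuation. The
  turn order stays an infinite sequence even then, with only its values below \<open>n\<close>
  consulted.\<close>

definition winning_positions ::
    "'s set \<Rightarrow> enat \<Rightarrow> (nat \<Rightarrow> player) \<Rightarrow> 's list set \<Rightarrow> 's list set \<Rightarrow> bool" where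
  "winning_positions S n a L T \<longleftrightarrow> T \<subseteq> L \<and>
     (\<forall>w\<in>T. enat (length w) < n \<longrightarrow>
        (case a (length w) of
           PlayerA \<Rightarrow> \<exists>s\<in>S. w @ [s] \<in> T
         | PlayerB \<Rightarrow> \<forall>s\<in>S. w @ [s] \<in> T))"

lemma winning_positions_step:
  assumes "winning_positions S n a L T" "w \<in> T" "enat (length w) < n"
  shows "case a (length w) of
           PlayerA \<Rightarrow> \<exists>s\<in>S. w @ [s] \<in> T
         | PlayerB \<Rightarrow> \<forall>s\<in>S. w @ [s] \<in> T"
  using assms unfolding winning_positions_def by blast

lemma length_play_prefix [simp]: "length (play_prefix a s\<^sub>A s\<^sub>B k) = k"
  by (induction k) simp_all

text \<open>A play of length \<open>k\<close> consults only shorter words. This allows a strategy of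
  B to be changed at one position without disturbing the play that led there.\<close>

lemma play_prefix_cong:
  assumes "\<And>i. i < k \<Longrightarrow> a i = b i" "\<And>w. length w < k \<Longrightarrow> s\<^sub>B w = t\<^sub>B w"
  shows "play_prefix a s\<^sub>A s\<^sub>B k = play_prefix b s\<^sub>A t\<^sub>B k"
  using assms by (induction k) (auto simp: choice_def split: player.splits)

lemma winning_positions_cong:
  assumes "\<And>i. enat i < n \<Longrightarrow> a i = b i" "winning_positions S n a L T"
  shows "winning_positions S n b L T"
  using assms unfolding winning_positions_def by auto

lemma winning_positions_mono:
  assumes "m \<le> n" "winning_positions S n a L T"
  shows "winning_positions S m a L T"
  using assms unfolding winning_positions_def by (meson order_less_le_trans)

text \<open>From a winning strategy, \<open>T\<close> is the set of positions reachable against some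
  strategy of B. Conversely, A follows \<open>T\<close> by choosing a letter that stays in it
  whenever there is one.\<close>

lemma winning_strategy_iff_positions:
  assumes "S \<noteq> {}" "L \<subseteq> lists S"
  shows "(\<exists>s\<^sub>A\<in>strategies S n. \<forall>s\<^sub>B\<in>strategies S n. \<forall>k. enat k \<le> n \<longrightarrow>
            play_prefix a s\<^sub>A s\<^sub>B k \<in> L) \<longleftrightarrow>
         (\<exists>T. [] \<in> T \<and> winning_positions S n a L T)"
    (is "?strategy \<longleftrightarrow> ?positions")
proof
  assume ?strategy
  then obtain s\<^sub>A where sA: "s\<^sub>A \<in> strategies S n"
    and win: "\<And>s\<^sub>B k. s\<^sub>B \<in> strategies S n \<Longrightarrow> enat k \<le> n \<Longrightarrow> play_prefix a s\<^sub>A s\<^sub>B k \<in> L"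
    by blast
  define T where "T = {play_prefix a s\<^sub>A s\<^sub>B k |s\<^sub>B k. s\<^sub>B \<in> strategies S n \<and> enat k \<le> n}"
  \<comment> \<open>The empty word is reachable only if B has some strategy; a constant one will
    do.\<close>
  obtain c where "c \<in> S" using assms(1) by blast
  then have "(\<lambda>_. c) \<in> strategies S n"
    unfolding strategies_def by blast
  then have "[] \<in> T"
    unfolding T_def by (force simp: zero_enat_def[symmetric] intro: exI[of _ 0])
  moreover have "T \<subseteq> L"
    unfolding T_def using win by blast
  moreover have "case a (length w) of
           PlayerA \<Rightarrow> \<exists>s\<in>S. w @ [s] \<in> T
         | PlayerB \<Rightarrow> \<forall>s\<in>S. w @ [s] \<in> T" if w: "w \<in> T" "enat (length w) < n" for w
  proof -
    obtain s\<^sub>B where sB: "s\<^sub>B \<in> strategies S n" "w = play_prefix a s\<^sub>A s\<^sub>B (length w)"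
      using w(1) unfolding T_def by auto
    have len: "enat (Suc (length w)) \<le> n"
      using w(2) by (simp add: Suc_ile_eq)
    show ?thesis
    proof (cases "a (length w)")
      case PlayerA
      have "play_prefix a s\<^sub>A s\<^sub>B (Suc (length w)) = w @ [s\<^sub>A w]"
        using sB(2) PlayerA by (simp add: choice_def)
      then have "w @ [s\<^sub>A w] \<in> T"
        unfolding T_def using sB(1) len by (metis (mono_tags, lifting) mem_Collect_eq)
      moreover have "s\<^sub>A w \<in> S"
        using sA w \<open>T \<subseteq> L\<close> assms(2) unfolding strategies_def by blast
      ultimately show ?thesis
        using PlayerA by auto
    next
      case PlayerB
      \<comment> \<open>Redirecting \<open>s\<^sub>B\<close> at \<open>w\<close> alone keeps the
        play up to \<open>w\<close>, so every reply of B is reachable.\<close>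
      have "w @ [s] \<in> T" if "s \<in> S" for s
      proof -
        have "play_prefix a s\<^sub>A (s\<^sub>B(w := s)) (length w) = w"
          by (subst (3) sB(2), rule play_prefix_cong) auto
        then have "play_prefix a s\<^sub>A (s\<^sub>B(w := s)) (Suc (length w)) = w @ [s]"
          using PlayerB by (simp add: choice_def)
        moreover have "s\<^sub>B(w := s) \<in> strategies S n"
          using sB(1) that unfolding strategies_def by auto
        ultimately show ?thesis
          unfolding T_def using len by (metis (mono_tags, lifting) mem_Collect_eq)
      qed
      then show ?thesis
        using PlayerB by auto
    qed
  qed
  ultimately show ?positions
    unfolding winning_positions_def by blast
next
  assume ?positions
  then obtain T where T: "[] \<in> T" "winning_positions S n a L T" by blast
  \<comment> \<open>Where no letter stays in \<open>T\<close> the value is an arbitrary letter of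
    \<open>S\<close>, so that \<open>s\<^sub>A\<close> is a strategy on all words.\<close>
  define s\<^sub>A where "s\<^sub>A w = (SOME s. s \<in> S \<and> ((\<exists>t\<in>S. w @ [t] \<in> T) \<longrightarrow> w @ [s] \<in> T))" for w
  have sA: "s\<^sub>A w \<in> S \<and> ((\<exists>t\<in>S. w @ [t] \<in> T) \<longrightarrow> w @ [s\<^sub>A w] \<in> T)" for w
    unfolding s\<^sub>A_def by (rule someI_ex) (use assms(1) in blast)
  have "play_prefix a s\<^sub>A s\<^sub>B k \<in> T" if "s\<^sub>B \<in> strategies S n" "enat k \<le> n" for s\<^sub>B k
    using that(2)
  proof (induction k)
    case 0
    then show ?case using T(1) by simp
  next
    case (Suc k)
    define w where "w = play_prefix a s\<^sub>A s\<^sub>B k"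
    have k: "enat k < n" using Suc.prems by (simp add: Suc_ile_eq)
    have w: "w \<in> T" "length w = k"
      using Suc.IH k unfolding w_def by simp_all
    have "w \<in> lists S"
      using w(1) T(2) assms(2) unfolding winning_positions_def by blast
    then have "s\<^sub>B w \<in> S"
      using that(1) k w(2) unfolding strategies_def by blast
    then show ?case
      using T(2) w k sA unfolding winning_positions_def
      by (auto simp: choice_def w_def[symmetric] split: player.splits)
  qed
  moreover have "s\<^sub>A \<in> strategies S n"
    using sA unfolding strategies_def by blast
  ultimately show ?strategy
    using T(2) unfolding winning_positions_def by blast
qed

section \<open>Restarting, enlarging and limits of sets of positions\<close>

text \<open>On a turn of B every letter stays in \<open>T\<close>, and \<open>S\<close> has one; on
  a turn of A some letter does by definition. This supplies positions at which the game can be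
  restarted.\<close>

lemma winning_positions_reach:
  assumes "S \<noteq> {}" "[] \<in> T" "winning_positions S \<infinity> a L T"
  shows "\<exists>v\<in>T. length v = i"
proof (induction i)
  case (Suc i)
  then obtain v where v: "v \<in> T" "length v = i" by blast
  then have "\<exists>s\<in>S. v @ [s] \<in> T"
    using winning_positions_step[OF assms(3), of v] assms(1) by (auto split: player.splits)
  then show ?case
    using v(2) by (metis length_append_singleton)
qed (use assms(2) in auto)

text \<open>Deleting the prefix \<open>v\<close> stays in the language, which is closed under
  factors. The new set contains the empty word exactly when \<open>v\<close> is in
  \<open>T\<close>.\<close>

lemma winning_positions_shift:
  assumes "winning_positions S \<infinity> a (language X) T"
  shows "winning_positions S \<infinity> (\<lambda>j. a (length v + j)) (language X) {w. v @ w \<in> T}"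
proof -
  have "case a (length v + length w) of
          PlayerA \<Rightarrow> \<exists>s\<in>S. w @ [s] \<in> {w. v @ w \<in> T}
        | PlayerB \<Rightarrow> \<forall>s\<in>S. w @ [s] \<in> {w. v @ w \<in> T}" if "v @ w \<in> T" for w
    using winning_positions_step[OF assms that] by (auto split: player.splits)
  moreover have "{w. v @ w \<in> T} \<subseteq> language X"
    using assms language_factor[of v _ "[]" X] unfolding winning_positions_def by auto
  ultimately show ?thesis
    unfolding winning_positions_def by blast
qed

text \<open>From length \<open>n\<close> on A moves alone and only has to stay in the language,
  where every word is extendable. So all longer words of the language may be added.\<close>

lemma winning_positions_extend:
  assumes "X \<subseteq> UNIV \<rightarrow> S" "winning_positions S (enat n) a (language X) T"
    "\<And>i. i \<ge> n \<Longrightarrow> a i = PlayerA"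
  shows "winning_positions S \<infinity> a (language X) {w \<in> language X. length w \<le> n \<longrightarrow> w \<in> T}"
    (is "winning_positions _ _ _ _ ?T'")
proof -
  have "case a (length w) of
          PlayerA \<Rightarrow> \<exists>s\<in>S. w @ [s] \<in> ?T'
        | PlayerB \<Rightarrow> \<forall>s\<in>S. w @ [s] \<in> ?T'" if "w \<in> ?T'" for w
  proof (cases "length w < n")
    \<comment> \<open>A continuation here has length at most \<open>n\<close>, so it must be found
      in \<open>T\<close> itself.\<close>
    case True
    then have "w \<in> T"
      using that by simp
    then show ?thesis
      using True assms(2) unfolding winning_positions_def
      by (fastforce split: player.splits)
  next
    case False
    then show ?thesis
      using assms(3) language_extend[OF assms(1), of w] that by auto
  qed
  then show ?thesis
    unfolding winning_positions_def by blast
qed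

text \<open>A good letter for A may depend on the horizon \<open>n\<close>, but a letter good for a
  large horizon is good for all smaller ones. As \<open>S\<close> is finite, one letter serves all
  horizons.\<close>

lemma winning_positions_limit:
  assumes "finite S"
  shows "winning_positions S \<infinity> a L {w. \<forall>n. \<exists>T. w \<in> T \<and> winning_positions S (enat n) a L T}"
proof -
  define P where "P n w \<longleftrightarrow> (\<exists>T. w \<in> T \<and> winning_positions S (enat n) a L T)" for n w
  have antimono: "P m w" if "P n w" "m \<le> n" for m n w
  proof -
    have "enat m \<le> enat n"
      using that(2) by simp
    then show ?thesis
      using that(1) winning_positions_mono unfolding P_def by blast
  qed
  have succ: "case a (length w) of
          PlayerA \<Rightarrow> \<exists>s\<in>S. P n (w @ [s])
        | PlayerB \<Rightarrow> \<forall>s\<in>S. P n (w @ [s])"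
    if "P n w" "length w < n" for w n
  proof -
    obtain T where T: "w \<in> T" "winning_positions S (enat n) a L T"
      using \<open>P n w\<close> unfolding P_def by blast
    then show ?thesis
      using winning_positions_step[OF T(2,1)] that(2) unfolding P_def
      by (auto split: player.splits)
  qed
  have "case a (length w) of
          PlayerA \<Rightarrow> \<exists>s\<in>S. w @ [s] \<in> {w. \<forall>n. P n w}
        | PlayerB \<Rightarrow> \<forall>s\<in>S. w @ [s] \<in> {w. \<forall>n. P n w}"
    if w: "\<And>n. P n w" for w
  proof (cases "a (length w)")
    case PlayerA
    have ex: "\<exists>s\<in>S. P n (w @ [s])" for n
    proof -
      \<comment> \<open>The horizon is raised beyond the length of \<open>w\<close> so that a move
        at \<open>w\<close> is guaranteed; afterwards it is lowered back to
        \<open>n\<close>.\<close>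
      have "\<exists>s\<in>S. P (n + Suc (length w)) (w @ [s])"
        using succ[OF w, of "n + Suc (length w)"] PlayerA by simp
      then show ?thesis
        using antimono le_add1 by blast
    qed
    have "\<exists>s\<in>S. \<forall>n. P n (w @ [s])"
    proof (rule ccontr)
      assume "\<not> ?thesis"
      \<comment> \<open>If each letter \<open>s\<close> fails at some horizon \<open>m s\<close>,
        then all of them fail at the largest of these, against \<open>ex\<close>.\<close>
      then obtain m where m: "\<And>s. s \<in> S \<Longrightarrow> \<not> P (m s) (w @ [s])"
        by metis
      obtain s where s: "s \<in> S" "P (Max (m ` S)) (w @ [s])"
        using ex by blast
      have "m s \<le> Max (m ` S)"
        using s(1) assms by simp
      then show False
        using antimono[OF s(2)] m[OF s(1)] by blast
    qed
    then show ?thesis using PlayerA by simp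
  next
    case PlayerB
    have "P n (w @ [s])" if "s \<in> S" for s n
    proof -
      have "P (n + Suc (length w)) (w @ [s])"
        using succ[OF w, of "n + Suc (length w)"] PlayerB that by simp
      then show ?thesis
        by (rule antimono) simp
    qed
    then show ?thesis using PlayerB by simp
  qed
  moreover have "{w. \<forall>n. P n w} \<subseteq> L"
    unfolding P_def winning_positions_def by blast
  ultimately have "winning_positions S \<infinity> a L {w. \<forall>n. P n w}"
    unfolding winning_positions_def by blast
  then show ?thesis
    unfolding P_def .
qed

section \<open>Winning sets in terms of positions\<close>

lemma winning_set_iff_positions:
  assumes "S \<noteq> {}" "subshift S X"
  shows "a \<in> winning_set S X \<longleftrightarrow> (\<exists>T. [] \<in> T \<and> winning_positions S \<infinity> a (language X) T)"
  using winning_strategy_iff_positions[OF assms(1)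
      language_subset_lists[OF subshift_subset[OF assms(2)]], of \<infinity> a]
  by (simp add: winning_set_def in_subshift_iff[OF assms(2)] play_prefix_eq)

text \<open>A finite game tests only its final word, but the language is closed under prefixes, so
  the final word is in it exactly when all positions of the play are.\<close>

lemma winning_language_iff_positions:
  assumes "S \<noteq> {}" "subshift S X"
  shows "u \<in> winning_language S (language X) \<longleftrightarrow>
    (\<exists>T. [] \<in> T \<and> winning_positions S (enat (length u)) ((!) u) (language X) T)"
proof -
  note lists = language_subset_lists[OF subshift_subset[OF assms(2)]]
  have "finite_play u s\<^sub>A s\<^sub>B \<in> language X \<inter> {w \<in> lists S. length w = length u} \<longleftrightarrow>
      (\<forall>k. enat k \<le> enat (length u) \<longrightarrow> play_prefix ((!) u) s\<^sub>A s\<^sub>B k \<in> language X)"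
    (is "?final \<longleftrightarrow> ?prefixes") for s\<^sub>A s\<^sub>B
  proof
    assume ?final
    then have "play_prefix ((!) u) s\<^sub>A s\<^sub>B (length u) \<in> language X"
      by (simp add: finite_play_def)
    then have "play_prefix ((!) u) s\<^sub>A s\<^sub>B k \<in> language X" if "k \<le> length u" for k
      using language_take[of "play_prefix ((!) u) s\<^sub>A s\<^sub>B (length u)" X k] that
      by (simp add: play_prefix_eq take_map take_upt)
    then show ?prefixes by simp
  next
    assume ?prefixes
    then show ?final
      using lists by (auto simp: finite_play_def)
  qed
  then show ?thesis
    unfolding winning_strategy_iff_positions[OF assms(1) lists, symmetric]
    by (auto simp: winning_language_def finite_winning_set_def)
qed

lemma language_winning_set:
  assumes "S \<noteq> {}" "subshift S X"
  shows "language (winning_set S X) = winning_language S (language X)"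
proof (intro equalityI subsetI)
  fix u assume "u \<in> language (winning_set S X)"
  then obtain a i where a: "a \<in> winning_set S X" "u = map a [i..<i + length u]"
    unfolding in_language_iff appears_in_def by blast
  obtain T where T: "[] \<in> T" "winning_positions S \<infinity> a (language X) T"
    using a(1) winning_set_iff_positions[OF assms] by blast
  \<comment> \<open>The word \<open>u\<close> may occur in \<open>a\<close> at a coordinate
    \<open>i\<close> other than 0. Restarting at a position of length \<open>i\<close> makes
    \<open>u\<close> the initial turns of the game.\<close>
  obtain v where v: "v \<in> T" "length v = i"
    using winning_positions_reach[OF assms(1) T] by blast
  have "winning_positions S (enat (length u)) (\<lambda>j. a (i + j)) (language X) {w. v @ w \<in> T}"
    using winning_positions_mono[OF _ winning_positions_shift[OF T(2), of v]] v(2) by simp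
  moreover have "a (i + j) = u ! j" if "j < length u" for j
    using that by (subst a(2)) simp
  ultimately have "winning_positions S (enat (length u)) ((!) u) (language X) {w. v @ w \<in> T}"
    using winning_positions_cong[of "enat (length u)" "\<lambda>j. a (i + j)" "(!) u"] by simp
  moreover have "[] \<in> {w. v @ w \<in> T}"
    using v(1) by simp
  ultimately show "u \<in> winning_language S (language X)"
    unfolding winning_language_iff_positions[OF assms] by (intro exI conjI)
next
  fix u assume "u \<in> winning_language S (language X)"
  then obtain T where T: "[] \<in> T" "winning_positions S (enat (length u)) ((!) u) (language X) T"
    unfolding winning_language_iff_positions[OF assms] by blast
  \<comment> \<open>All turns after \<open>u\<close> go to A, so that B cannot force the play out of
    the language once the finite game is over.\<close>
  define a where "a i = (if i < length u then u ! i else PlayerA)" for i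
  have "winning_positions S (enat (length u)) a (language X) T"
    by (rule winning_positions_cong[OF _ T(2)]) (simp add: a_def)
  then have "winning_positions S \<infinity> a (language X) {w \<in> language X. length w \<le> length u \<longrightarrow> w \<in> T}"
    by (rule winning_positions_extend[OF subshift_subset[OF assms(2)]]) (simp add: a_def)
  moreover have "[] \<in> {w \<in> language X. length w \<le> length u \<longrightarrow> w \<in> T}"
    using T unfolding winning_positions_def by blast
  ultimately have "a \<in> winning_set S X"
    unfolding winning_set_iff_positions[OF assms] by (intro exI conjI)
  moreover have "u = map a [0..<length u]"
    by (rule nth_equalityI) (simp_all add: a_def)
  ultimately show "u \<in> language (winning_set S X)"
    using prefix_in_language by metis
qed

theorem proposition3p4:
  fixes S :: "'s set" and X :: "(nat \<Rightarrow> 's) set"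
  assumes "finite S" and "S \<noteq> {}" and "subshift S X"
  shows "subshift (UNIV :: player set) (winning_set S X) \<and>
         language (winning_set S X) = winning_language S (language X)"
proof
  show lang: "language (winning_set S X) = winning_language S (language X)"
    by (rule language_winning_set[OF assms(2,3)])
  \<comment> \<open>Each prefix of \<open>a\<close> gives a set of positions for a finite game; the
    limit of these sets wins the infinite game.\<close>
  have closed: "a \<in> winning_set S X"
    if "\<And>w. appears_in w a \<Longrightarrow> w \<in> winning_language S (language X)" for a
  proof -
    have "\<exists>T. [] \<in> T \<and> winning_positions S (enat n) a (language X) T" for n
    proof -
      have "appears_in (map a [0..<n]) a"
        unfolding appears_in_def by (metis add_0 diff_zero length_map length_upt)
      then have "map a [0..<n] \<in> winning_language S (language X)"
        by (rule that)
      then obtain T where "[] \<in> T" "winning_positions S (enat n) ((!) (map a [0..<n])) (language X) T"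
        using winning_language_iff_positions[OF assms(2,3)] by auto
      then show ?thesis
        using winning_positions_cong[of "enat n" "(!) (map a [0..<n])" a] by auto
    qed
    then have "[] \<in> {w. \<forall>n. \<exists>T. w \<in> T \<and> winning_positions S (enat n) a (language X) T}"
      by simp
    then show ?thesis
      unfolding winning_set_iff_positions[OF assms(2,3)]
      using winning_positions_limit[OF assms(1)] by (intro exI conjI)
  qed
  \<comment> \<open>The forbidden words are all those outside the language of the winning set.
    Avoiding them puts every factor of \<open>a\<close> into that language, and \<open>lang\<close>
    carries it to the winning language, as \<open>closed\<close> demands.\<close>
  have "winning_set S X = {a \<in> UNIV \<rightarrow> UNIV. \<forall>w \<in> - language (winning_set S X). \<not> appears_in w a}"
    (is "_ = ?R")
  proof (intro equalityI subsetI)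
    fix a assume "a \<in> winning_set S X"
    then show "a \<in> ?R"
      by (auto simp: in_language_iff)
  next
    fix a assume "a \<in> ?R"
    then show "a \<in> winning_set S X"
      using closed lang by blast
  qed
  then show "subshift (UNIV :: player set) (winning_set S X)"
    unfolding subshift_def lists_UNIV by (intro exI conjI subset_UNIV)
qed

end
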